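(* Let $M$ be a topological monoid such that $M$ is extendible to a locally compact Hausdorff group $G$ and such that $M$ is positive in the identity (as a subset of $G$). Then for any Banach space $\mathcal{E}$, every WOT-continuous semigroup $T:M\to\mathfrak{L}(\mathcal{E})$ is SOT-continuous. In particular, $M$ is "good".
   Context: A topological monoid $(M,\cdot,1)$ (not necessarily commutative) is a monoid with a topology making multiplication continuous. $M$ is extendible to a locally compact Hausdorff topological group $G$ if $M$ is topologically and algebraically isomorphic to a closed subset of $G$; in this case $M$ is identified with that closed subset, so $M\subseteq G$. A subset $A$ of a locally compact Hausdorff group $G$ is called positive in the identity if for every neighbourhood $U\subseteq G$ of the group identity, $U\cap A$ has non-empty interior within $G$. $\mathfrak{L}(\mathcal{E})$ denotes the bounded linear operators on $\mathcal{E}$; WOT and SOT denote the weak and strong operator topologies. A semigroup over a Banach space $\mathcal{E}$ on $M$ is a function $T:M\to\mathfrak{L}(\mathcal{E})$ with $T(1)=\mathbf{I}$ and $T(st)=T(s)T(t)$ for all $s,t\in M$. Let $\mathcal{H}$ be a fixed separable infinite-dimensional (complex) Hilbert space. $M$ is called "good" if every WOT-continuous semigroup over $\mathcal{H}$ on $M$ with contractive values (operators of norm $\le 1$) is SOT-continuous. *)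

theory Defs
  imports "HOL-Analysis.Analysis"
begin

section \<open>Complex Banach and Hilbert spaces\<close>

text \<open>
  A complex normed space is a real normed space together with a scalar multiplication by complex
  numbers that extends the given real one. Hence bounded complex-linear maps are those elements of
  the library type of bounded (real-)linear maps that are homogeneous over the complex numbers.
\<close>

class complex_normed_vector = real_normed_vector +
  fixes scaleC :: "complex \<Rightarrow> 'a \<Rightarrow> 'a" (infixr \<open>*\<^sub>C\<close> 75)
  assumes scaleC_add_right: "c *\<^sub>C (x + y) = c *\<^sub>C x + c *\<^sub>C y"
    and scaleC_add_left: "(c + d) *\<^sub>C x = c *\<^sub>C x + d *\<^sub>C x"
    and scaleC_scaleC: "c *\<^sub>C (d *\<^sub>C x) = (c * d) *\<^sub>C x"
    and scaleC_of_real: "complex_of_real r *\<^sub>C x = r *\<^sub>R x"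
    and norm_scaleC: "norm (c *\<^sub>C x) = cmod c * norm x"

class cbanach = complex_normed_vector + banach

class chilbert_space = cbanach +
  fixes cinner :: "'a \<Rightarrow> 'a \<Rightarrow> complex"
  assumes cinner_add_left: "cinner (x + y) z = cinner x z + cinner y z"
    and cinner_scaleC_left: "cinner (c *\<^sub>C x) y = c * cinner x y"
    and cinner_commute: "cinner x y = cnj (cinner y x)"
    and cinner_self: "cinner x x = complex_of_real ((norm x)\<^sup>2)"

instantiation complex :: chilbert_space
begin

definition scaleC_complex :: "complex \<Rightarrow> complex \<Rightarrow> complex"
  where "scaleC_complex c x = c * x"

definition cinner_complex :: "complex \<Rightarrow> complex \<Rightarrow> complex"
  where "cinner_complex x y = x * cnj y"

instance
  by standard
    (auto simp: scaleC_complex_def cinner_complex_def algebra_simps scaleR_conv_of_real norm_mult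
      complex_norm_square simp flip: of_real_power)

end

global_interpretation complex_vector:
  vector_space "scaleC :: complex \<Rightarrow> 'a \<Rightarrow> 'a::complex_normed_vector"
  defines cspan = complex_vector.span
proof
  fix x :: 'a
  show "1 *\<^sub>C x = x"
    using scaleC_of_real[of 1 x] by simp
qed (simp_all add: scaleC_add_right scaleC_add_left scaleC_scaleC)

definition infinite_cdim :: "'h::complex_normed_vector itself \<Rightarrow> bool"
  where "infinite_cdim _ \<longleftrightarrow> \<not> (\<exists>B :: 'h set. finite B \<and> cspan B = UNIV)"

definition complex_linear ::
    "('a::complex_normed_vector \<Rightarrow>\<^sub>L 'b::complex_normed_vector) \<Rightarrow> bool"
  where "complex_linear A \<longleftrightarrow>
    (\<forall>c x. blinfun_apply A (c *\<^sub>C x) = c *\<^sub>C blinfun_apply A x)"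


section \<open>Weak operator topologies\<close>

text \<open>
  The strong operator topology is the library's \<^const>\<open>strong_operator_topology\<close>. The weak operator
  topology is the initial topology for the maps sending \<open>A\<close> to \<open>\<phi> (A x)\<close>, where \<open>\<phi>\<close> ranges over
  the dual space: all bounded functionals in the real case, the complex-linear ones in the complex
  case. In the complex case both topologies are placed on the larger type of bounded real-linear
  maps; they induce the usual operator topologies on the set of complex-linear ones, and a map with
  complex-linear values is continuous into the subspace iff it is continuous into the whole space.
\<close>

definition weak_operator_topology_wrt ::
    "('b::real_normed_vector \<Rightarrow>\<^sub>L 'k::real_normed_vector) set
      \<Rightarrow> ('a::real_normed_vector \<Rightarrow>\<^sub>L 'b) topology"
  where "weak_operator_topology_wrt \<Phi> =
    topology_generated_by
      {{A. blinfun_apply \<phi> (blinfun_apply A x) \<in> U} | \<phi> x U. \<phi> \<in> \<Phi> \<and> open U}"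

definition real_weak_operator_topology ::
    "('a::real_normed_vector \<Rightarrow>\<^sub>L 'b::real_normed_vector) topology"
  where "real_weak_operator_topology = weak_operator_topology_wrt (UNIV :: ('b \<Rightarrow>\<^sub>L real) set)"

definition complex_weak_operator_topology ::
    "('a::complex_normed_vector \<Rightarrow>\<^sub>L 'b::complex_normed_vector) topology"
  where "complex_weak_operator_topology =
    weak_operator_topology_wrt {\<phi> :: 'b \<Rightarrow>\<^sub>L complex. complex_linear \<phi>}"


section \<open>Operator semigroups over a monoid\<close>

definition operator_semigroup ::
    "('m::monoid_mult \<Rightarrow> ('e::real_normed_vector \<Rightarrow>\<^sub>L 'e)) \<Rightarrow> bool"
  where "operator_semigroup T \<longleftrightarrow>
    T 1 = id_blinfun \<and> (\<forall>s t. T (s * t) = T s o\<^sub>L T t)"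

definition complex_operator_semigroup ::
    "('m::monoid_mult \<Rightarrow> ('e::complex_normed_vector \<Rightarrow>\<^sub>L 'e)) \<Rightarrow> bool"
  where "complex_operator_semigroup T \<longleftrightarrow>
    operator_semigroup T \<and> (\<forall>t. complex_linear (T t))"

definition good :: "'m::topological_monoid_mult itself \<Rightarrow> 'h::chilbert_space itself \<Rightarrow> bool"
  where "good _ _ \<longleftrightarrow>
    (\<forall>T :: 'm \<Rightarrow> ('h \<Rightarrow>\<^sub>L 'h).
      complex_operator_semigroup T \<longrightarrow> (\<forall>t. norm (T t) \<le> 1) \<longrightarrow>
      continuous_map euclidean complex_weak_operator_topology T \<longrightarrow>
      continuous_map euclidean strong_operator_topology T)"


section \<open>Monoids inside topological groups\<close>

text \<open>
  The ambient group is written additively, since that is how the library provides topological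
  groups; neither \<^class>\<open>group_add\<close> nor \<^class>\<open>topological_group_add\<close> assumes commutativity.
  The map \<open>\<iota>\<close> identifies the monoid with the closed subset \<open>range \<iota>\<close> of the group.
\<close>

definition closed_monoid_embedding ::
    "('m::topological_monoid_mult \<Rightarrow> 'g::topological_group_add) \<Rightarrow> bool"
  where "closed_monoid_embedding \<iota> \<longleftrightarrow>
    \<iota> 1 = 0 \<and> (\<forall>s t. \<iota> (s * t) = \<iota> s + \<iota> t) \<and>
    embedding_map euclidean euclidean \<iota> \<and> closed (range \<iota>)"

definition positive_in_identity :: "'g::topological_group_add set \<Rightarrow> bool"
  where "positive_in_identity A \<longleftrightarrow>
    (\<forall>U. 0 \<in> interior U \<longrightarrow> interior (U \<inter> A) \<noteq> {})"

end

theory Submission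
  imports Defs
begin

text \<open>
  The proof combines a category argument with translations in the group. Fix \<open>x\<close> and let
  \<open>f s = T s x\<close>, a weakly continuous map on the monoid \<open>M\<close>, viewed as a subset of the group \<open>G\<close>.

  On the interior of \<open>M\<close> in \<open>G\<close>, a locally compact Hausdorff space, the weakly continuous \<open>f\<close> has a
  dense set of points of norm continuity (\<open>weakly_continuous_norm_continuity_point\<close>). If \<open>u\<close> is such
  a point, then the whole orbit \<open>t \<mapsto> T t (T u x) = f (t * u)\<close> is norm-continuous: near \<open>t * u\<close> the
  map \<open>f\<close> is the composition of the left translation by \<open>- t\<close> in \<open>G\<close>, which leads back to
  a neighbourhood of \<open>u\<close> inside \<open>M\<close>, the map \<open>f\<close> near \<open>u\<close>, and the bounded operator \<open>T t\<close>
  (\<open>continuity_vector_if_continuous_at_interior\<close>).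

  Hence all these \<open>T u x\<close> belong to the space \<open>D\<close> of vectors with norm-continuous orbits. This
  subspace is closed because \<open>T\<close> is locally bounded, by the uniform boundedness principle
  (\<open>locally_bounded_if_weakly_continuous\<close>, \<open>closed_continuity_vectors\<close>), and so it is weakly closed by the
  Hahn-Banach theorem (\<open>functional_infdist\<close>). As \<open>M\<close> is positive in the identity, the points \<open>u\<close>
  accumulate at the identity, where \<open>T u x\<close> tends weakly to \<open>x\<close>. So \<open>x\<close> lies in \<open>D\<close>.
  Continuity points thus take the place of averages of \<open>T\<close> against a Haar measure.

  The complex case follows since every real functional is the real part of a complex-linear one,
  and goodness is the case of contractions on a Hilbert space.
\<close>

section \<open>The Hahn-Banach theorem and uniform boundedness\<close>

text \<open>
  The homogeneity inequality for \<open>c\<close> and for \<open>inverse c\<close> together give equality; the one-sided form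
  is what can be checked directly for infima.
\<close>

definition sublinear :: "('a::real_vector \<Rightarrow> real) \<Rightarrow> bool"
  where "sublinear p \<longleftrightarrow> (\<forall>x y. p (x + y) \<le> p x + p y) \<and> (\<forall>c>0. \<forall>x. p (c *\<^sub>R x) \<le> c * p x)"

lemma sublinearI:
  assumes "\<And>x y. p (x + y) \<le> p x + p y" "\<And>c x. c > 0 \<Longrightarrow> p (c *\<^sub>R x) \<le> c * p x"
  shows "sublinear p"
  using assms by (auto simp: sublinear_def)

lemma sublinear_add: "sublinear p \<Longrightarrow> p (x + y) \<le> p x + p y"
  by (auto simp: sublinear_def)

lemma sublinear_zero:
  assumes "sublinear p" shows "p 0 = 0"
proof -
  have "p (c *\<^sub>R 0) \<le> c * p 0" if "c > 0" for c
    using assms that by (simp only: sublinear_def)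
  from this[of "1/2"] this[of 2] show ?thesis by simp
qed

lemma sublinear_scaleR:
  assumes "sublinear p" "c \<ge> 0" shows "p (c *\<^sub>R x) = c * p x"
proof (cases "c = 0")
  case True
  then show ?thesis by (simp add: sublinear_zero assms)
next
  case False
  then have c: "c > 0" using assms by simp
  have "p (inverse c *\<^sub>R (c *\<^sub>R x)) \<le> inverse c * p (c *\<^sub>R x)"
    using assms c unfolding sublinear_def by (metis positive_imp_inverse_positive)
  then have "c * p x \<le> p (c *\<^sub>R x)"
    using c by (simp add: field_simps)
  moreover have "p (c *\<^sub>R x) \<le> c * p x"
    using assms c by (simp add: sublinear_def)
  ultimately show ?thesis by simp
qed

lemma sublinear_minus: "sublinear p \<Longrightarrow> - p (- x) \<le> p x"
  using sublinear_add[of p x "- x"] sublinear_zero[of p] by simp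

text \<open>
  The infimum of \<open>p (x + t *\<^sub>R y) - t * p y\<close> over \<open>t \<ge> 0\<close> is the largest sublinear functional \<open>q \<le> p\<close>
  with \<open>q (- y) = - p y\<close>. A minimal sublinear functional cannot be lowered in
  this way in any direction, which forces additivity; one tilt along \<open>x0\<close> before minimising fixes
  the value at \<open>x0\<close>.
\<close>

lemma sublinear_tilt:
  assumes p: "sublinear p"
  obtains q where "sublinear q" "\<And>x. q x \<le> p x" "\<And>x. q x \<le> p (x + y) - p y"
proof
  define g where "g x t = p (x + t *\<^sub>R y) - t * p y" for x t
  define q where "q x = (INF t\<in>{0..}. g x t)" for x
  have bdd: "bdd_below (g x ` {0..})" for x
  proof (rule bdd_belowI2)
    fix t :: real assume "t \<in> {0..}"
    moreover have "p (t *\<^sub>R y) \<le> p (x + t *\<^sub>R y) + p (- x)"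
      using sublinear_add[OF p, of "x + t *\<^sub>R y" "- x"] by simp
    ultimately show "- p (- x) \<le> g x t"
      by (simp add: g_def sublinear_scaleR[OF p])
  qed
  have le: "q x \<le> g x t" if "t \<ge> 0" for x t
    unfolding q_def by (rule cINF_lower[OF bdd]) (use that in simp)
  have ge: "z \<le> q x" if "\<And>t. t \<ge> 0 \<Longrightarrow> z \<le> g x t" for x z
    unfolding q_def by (rule cINF_greatest) (use that in auto)
  show "q x \<le> p x" for x
    using le[of 0 x] by (simp add: g_def)
  show "q x \<le> p (x + y) - p y" for x
    using le[of 1 x] by (simp add: g_def)
  show "sublinear q"
  proof (rule sublinearI)
    fix x x' :: 'a
    have "q (x + x') \<le> g x s + g x' t" if "s \<ge> 0" "t \<ge> 0" for s t
    proof -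
      have "q (x + x') \<le> g (x + x') (s + t)" using that by (intro le) simp
      also have "\<dots> \<le> g x s + g x' t"
        using sublinear_add[OF p, of "x + s *\<^sub>R y" "x' + t *\<^sub>R y"]
        by (simp add: g_def algebra_simps)
      finally show ?thesis .
    qed
    then have "q (x + x') - g x' t \<le> q x" if "t \<ge> 0" for t
      using that by (intro ge) (simp add: algebra_simps)
    then have "q (x + x') - q x \<le> q x'"
      by (intro ge) (simp add: algebra_simps)
    then show "q (x + x') \<le> q x + q x'" by simp
  next
    fix c :: real and x :: 'a assume c: "c > 0"
    have "q (c *\<^sub>R x) / c \<le> q x"
    proof (rule ge)
      fix t :: real assume t: "t \<ge> 0"
      have "q (c *\<^sub>R x) \<le> g (c *\<^sub>R x) (c * t)" using t c by (intro le) simp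
      also have "\<dots> = c * g x t"
        using sublinear_scaleR[OF p, of c "x + t *\<^sub>R y"] c by (simp add: g_def algebra_simps)
      finally show "q (c *\<^sub>R x) / c \<le> g x t" using c by (simp add: field_simps)
    qed
    then show "q (c *\<^sub>R x) \<le> c * q x" using c by (simp add: field_simps)
  qed
qed

lemma linear_if_minimal_sublinear:
  assumes q: "sublinear q" and min: "\<And>r. sublinear r \<Longrightarrow> (\<And>x. r x \<le> q x) \<Longrightarrow> r = q"
  shows "linear q"
proof -
  have ge: "q x + q y \<le> q (x + y)" for x y
  proof -
    obtain r where "sublinear r" "\<And>x. r x \<le> q x" "\<And>x. r x \<le> q (x + y) - q y"
      using sublinear_tilt[OF q] by blast
    then have "q x \<le> q (x + y) - q y" using min by metis
    then show ?thesis by simp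
  qed
  have add: "q (x + y) = q x + q y" for x y
    using ge[of x y] sublinear_add[OF q, of x y] by simp
  have minus: "q (- x) = - q x" for x
    using add[of x "- x"] sublinear_zero[OF q] by simp
  show ?thesis
  proof (rule linearI)
    show "q (x + y) = q x + q y" for x y by (rule add)
    show "q (c *\<^sub>R x) = c *\<^sub>R q x" for c x
    proof (cases "c \<ge> 0")
      case True
      then show ?thesis using sublinear_scaleR[OF q] by simp
    next
      case False
      then show ?thesis
        using sublinear_scaleR[OF q, of "- c" x] minus[of "c *\<^sub>R x"] by simp
    qed
  qed
qed

text \<open>
  Zorn's lemma: the pointwise infimum of a chain is finite because every sublinear \<open>q \<le> p\<close>
  satisfies \<open>q x \<ge> - p (- x)\<close>, and it is subadditive because two members of a chain can be replaced
  by the smaller one.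
\<close>

lemma minimal_sublinear_exists:
  assumes p: "sublinear p"
  obtains q where "sublinear q" "\<And>x. q x \<le> p x"
    "\<And>r. sublinear r \<Longrightarrow> (\<And>x. r x \<le> q x) \<Longrightarrow> r = q"
proof -
  define A where "A = {q. sublinear q \<and> (\<forall>x. q x \<le> p x)}"
  define P where "P = (\<lambda>q r. \<forall>x::'a. r x \<le> (q x::real))"
  have "\<exists>m\<in>A. \<forall>a\<in>A. P m a \<longrightarrow> a = m"
  proof (rule predicate_Zorn)
    show "partial_order_on A (relation_of P A)"
      by (rule partial_order_on_relation_ofI) (auto simp: P_def fun_eq_iff intro: order_trans antisym)
    fix C assume C: "C \<in> Chains (relation_of P A)"
    then have CA: "C \<subseteq> A" and tot: "\<And>q r. q \<in> C \<Longrightarrow> r \<in> C \<Longrightarrow> P q r \<or> P r q"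
      by (auto simp: Chains_def relation_of_def)
    show "\<exists>u\<in>A. \<forall>a\<in>C. P a u"
    proof (cases "C = {}")
      case True
      then show ?thesis using p by (auto simp: A_def)
    next
      case False
      define u where "u x = (INF q\<in>C. q x)" for x
      have "- p (- x) \<le> q x" if "q \<in> C" for q x
        using CA that sublinear_minus[of q x] by (fastforce simp: A_def dest!: subsetD intro: order_trans[rotated])
      then have bdd: "bdd_below ((\<lambda>q. q x) ` C)" for x
        by (intro bdd_belowI2)
      have le: "u x \<le> q x" if "q \<in> C" for q x
        unfolding u_def by (rule cINF_lower[OF bdd that])
      have ge: "z \<le> u x" if "\<And>q. q \<in> C \<Longrightarrow> z \<le> q x" for x z
        unfolding u_def using False that by (rule cINF_greatest)
      have sub: "sublinear q" if "q \<in> C" for q using that CA by (auto simp: A_def)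
      have "sublinear u"
      proof (rule sublinearI)
        fix x y
        have "u (x + y) \<le> q x + r y" if "q \<in> C" "r \<in> C" for q r
          using tot[OF that]
        proof
          assume "P q r"
          then show ?thesis
            using le[OF that(2), of "x + y"] sublinear_add[OF sub[OF that(2)], of x y]
            by (force simp: P_def dest: spec[of _ x])
        next
          assume "P r q"
          then show ?thesis
            using le[OF that(1), of "x + y"] sublinear_add[OF sub[OF that(1)], of x y]
            by (force simp: P_def dest: spec[of _ y])
        qed
        then have "u (x + y) - r y \<le> u x" if "r \<in> C" for r
          using that by (intro ge) (simp add: algebra_simps)
        then have "u (x + y) - u x \<le> u y"
          by (intro ge) (simp add: algebra_simps)
        then show "u (x + y) \<le> u x + u y" by simp
      next
        fix c :: real and x assume c: "c > 0"
        have "u (c *\<^sub>R x) / c \<le> u x"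
          using le[of _ "c *\<^sub>R x"] sublinear_scaleR[OF sub, of _ c x] c
          by (intro ge) (simp add: field_simps)
        then show "u (c *\<^sub>R x) \<le> c * u x" using c by (simp add: field_simps)
      qed
      moreover obtain q where "q \<in> C" using False by blast
      then have "u x \<le> p x" for x
        using le[of q x] CA by (force simp: A_def intro: order_trans)
      ultimately have "u \<in> A" by (simp add: A_def)
      then show ?thesis using le by (auto simp: P_def)
    qed
  qed
  then obtain q where q: "q \<in> A" "\<And>r. r \<in> A \<Longrightarrow> P q r \<Longrightarrow> r = q" by blast
  show thesis
  proof
    show "sublinear q" "\<And>x. q x \<le> p x" using q by (auto simp: A_def)
    then show "r = q" if "sublinear r" "\<And>x. r x \<le> q x" for r
      using that by (intro q(2)) (auto simp: A_def P_def intro: order_trans)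
  qed
qed

text \<open>
  The inequality \<open>\<phi> x0 \<ge> p x0\<close> comes from the tilt along \<open>x0\<close>, which forces the value at \<open>- x0\<close> to
  be at most \<open>- p x0\<close>.
\<close>

theorem Hahn_Banach_sublinear:
  assumes p: "sublinear p"
  obtains \<phi> where "linear \<phi>" "\<And>x. \<phi> x \<le> p x" "\<phi> x0 = p x0"
proof -
  obtain r where r: "sublinear r" "\<And>x. r x \<le> p x" "\<And>x. r x \<le> p (x + x0) - p x0"
    using sublinear_tilt[OF p] by blast
  obtain q where q: "sublinear q" "\<And>x. q x \<le> r x"
      "\<And>s. sublinear s \<Longrightarrow> (\<And>x. s x \<le> q x) \<Longrightarrow> s = q"
    using minimal_sublinear_exists[OF r(1)] by blast
  have lin: "linear q" by (rule linear_if_minimal_sublinear[OF q(1) q(3)])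
  have le: "q x \<le> p x" for x using q(2) r(2) order_trans by blast
  have "q (- x0) \<le> - p x0"
    using q(2)[of "- x0"] r(3)[of "- x0"] sublinear_zero[OF p] by simp
  then have "q x0 = p x0" using le[of x0] linear_neg[OF lin, of x0] by simp
  with lin le that show thesis by blast
qed

lemma sublinear_infdist:
  fixes L :: "'a::real_normed_vector set"
  assumes L: "subspace L"
  shows "sublinear (\<lambda>x. infdist x L)"
proof -
  have ne: "L \<noteq> {}" using subspace_0[OF L] by blast
  have ge: "z \<le> infdist x L" if "\<And>a. a \<in> L \<Longrightarrow> z \<le> dist x a" for x z
    unfolding infdist_notempty[OF ne] using ne that by (rule cINF_greatest)
  show ?thesis
  proof (rule sublinearI)
    fix x y :: 'a
    have "infdist (x + y) L \<le> dist x a + dist y b" if "a \<in> L" "b \<in> L" for a b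
      using infdist_le[OF subspace_add[OF L that], of "x + y"] dist_triangle_add[of x y a b] by simp
    then have "infdist (x + y) L - dist y b \<le> infdist x L" if "b \<in> L" for b
      using that by (intro ge) (simp add: algebra_simps)
    then have "infdist (x + y) L - infdist x L \<le> infdist y L"
      by (intro ge) (simp add: algebra_simps)
    then show "infdist (x + y) L \<le> infdist x L + infdist y L" by simp
  next
    fix c :: real and x :: 'a assume c: "c > 0"
    have "infdist (c *\<^sub>R x) L / c \<le> infdist x L"
    proof (rule ge)
      fix a assume "a \<in> L"
      then have "infdist (c *\<^sub>R x) L \<le> dist (c *\<^sub>R x) (c *\<^sub>R a)"
        using subspace_scale[OF L] by (intro infdist_le) auto
      also have "\<dots> = c * dist x a"
        using c by (simp add: dist_norm flip: scaleR_diff_right)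
      finally show "infdist (c *\<^sub>R x) L / c \<le> dist x a"
        using c by (simp add: field_simps)
    qed
    then show "infdist (c *\<^sub>R x) L \<le> c * infdist x L" using c by (simp add: field_simps)
  qed
qed

text \<open>
  The distance to a subspace is sublinear, vanishes on the subspace and is dominated by the norm.
  Applied to it, the Hahn-Banach theorem yields separation from closed subspaces and, for the
  zero subspace, norming functionals.
\<close>

lemma functional_infdist:
  fixes L :: "'a::real_normed_vector set"
  assumes L: "subspace L"
  obtains \<phi> :: "'a \<Rightarrow>\<^sub>L real"
    where "norm \<phi> \<le> 1" "\<And>z. z \<in> L \<Longrightarrow> \<phi> z = 0" "\<phi> x = infdist x L"
proof -
  obtain f where f: "linear f" "\<And>y. f y \<le> infdist y L" "f x = infdist x L"
    using Hahn_Banach_sublinear[OF sublinear_infdist[OF L]] by blast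
  have abs: "\<bar>f y\<bar> \<le> infdist y L" for y
  proof -
    have "infdist (- y) L \<le> infdist y L"
    proof -
      have "infdist (- y) L \<le> dist y a" if "a \<in> L" for a
        using infdist_le[OF subspace_neg[OF L that], of "- y"] by (simp add: dist_norm norm_minus_commute)
      then show ?thesis
        using subspace_0[OF L] by (subst (2) infdist_notempty) (auto intro: cINF_greatest)
    qed
    then show ?thesis
      using f(2)[of y] f(2)[of "- y"] linear_neg[OF f(1), of y] by simp
  qed
  have bound: "norm (f y) \<le> norm y" for y
    using abs[of y] infdist_le[OF subspace_0[OF L], of y] by simp
  have bl: "bounded_linear f"
    using f(1) bound by (intro bounded_linear_intro[of f 1]) (auto simp: linear_add linear_scale)
  show thesis
  proof
    show "norm (Blinfun f) \<le> 1"
      using bound by (intro norm_blinfun_bound) (auto simp: bounded_linear_Blinfun_apply[OF bl])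
    show "blinfun_apply (Blinfun f) z = 0" if "z \<in> L" for z
      using abs[of z] that by (simp add: bounded_linear_Blinfun_apply[OF bl])
    show "blinfun_apply (Blinfun f) x = infdist x L"
      by (simp add: bounded_linear_Blinfun_apply[OF bl] f)
  qed
qed

lemma norming_functional:
  fixes x :: "'a::real_normed_vector"
  obtains \<phi> :: "'a \<Rightarrow>\<^sub>L real" where "norm \<phi> \<le> 1" "\<phi> x = norm x"
  using functional_infdist[OF subspace_single_0, of x] by auto

theorem uniform_boundedness:
  fixes F :: "('a::banach \<Rightarrow>\<^sub>L 'b::real_normed_vector) set"
  assumes "\<And>x. bounded ((\<lambda>A. blinfun_apply A x) ` F)"
  shows "bounded F"
proof -
  define S where "S n = {x. \<forall>A\<in>F. norm (blinfun_apply A x) \<le> real n}" for n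
  have "\<exists>n. x \<in> S n" for x
  proof -
    obtain B where "\<And>A. A \<in> F \<Longrightarrow> norm (blinfun_apply A x) \<le> B"
      using assms[of x] by (auto simp: bounded_iff)
    then show ?thesis
      unfolding S_def using real_arch_simple[of B] by (force intro: order_trans)
  qed
  then have UN: "\<Union> (range S) = UNIV" by blast
  have S_eq: "S n = (\<Inter>A\<in>F. {x. norm (blinfun_apply A x) \<le> real n})" for n
    by (auto simp: S_def)
  have cl: "closed (S n)" for n
    unfolding S_eq by (auto intro!: closed_INT closed_Collect_le continuous_intros)
  have "\<exists>n. interior (S n) \<noteq> {}"
  proof (rule ccontr)
    assume "\<not> ?thesis"
    then have "(euclidean :: 'a topology) interior_of \<Union> (range S) = {}"
      using cl by (intro Baire_category_alt) (auto intro: completely_metrizable_space_euclidean)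
    then show False by (simp add: UN)
  qed
  then obtain n x0 where "x0 \<in> interior (S n)" by blast
  then obtain r where r: "r > 0" "cball x0 r \<subseteq> S n"
    by (auto simp: mem_interior_cball)
  have "norm A \<le> 2 * real n / r" if A: "A \<in> F" for A
  proof (rule norm_blinfun_bound)
    show "0 \<le> 2 * real n / r" using r by simp
    fix y
    show "norm (blinfun_apply A y) \<le> 2 * real n / r * norm y"
    proof (cases "y = 0")
      case False
      \<comment> \<open>\<open>z\<close> is rescaled to length \<open>r\<close>, and is a difference of two points of \<open>S n\<close>.\<close>
      define z where "z = (r / norm y) *\<^sub>R y"
      have "x0 + z \<in> S n" "x0 \<in> S n"
        using r False by (auto simp: z_def dist_norm intro!: subsetD[OF r(2)])
      then have "norm (blinfun_apply A (x0 + z)) \<le> n" "norm (blinfun_apply A x0) \<le> n"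
        using A by (auto simp: S_def)
      then have "norm (blinfun_apply A z) \<le> 2 * real n"
        using norm_triangle_ineq4[of "blinfun_apply A (x0 + z)" "blinfun_apply A x0"]
        by (simp add: blinfun.add_right)
      then show ?thesis
        using r False by (simp add: z_def blinfun.scaleR_right field_simps)
    qed simp
  qed
  then show ?thesis by (auto simp: bounded_iff)
qed

text \<open>
  Vectors act on the dual space by evaluation, without loss of norm; the dual space is complete
  even if the space itself is not.
\<close>

lemma bounded_if_weakly_bounded:
  fixes S :: "'a::real_normed_vector set"
  assumes "\<And>\<phi> :: 'a \<Rightarrow>\<^sub>L real. bounded (blinfun_apply \<phi> ` S)"
  shows "bounded S"
proof -
  define ev :: "'a \<Rightarrow> ('a \<Rightarrow>\<^sub>L real) \<Rightarrow>\<^sub>L real" where "ev y = Blinfun (\<lambda>\<phi>. blinfun_apply \<phi> y)" for y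
  have ev: "blinfun_apply (ev y) \<phi> = blinfun_apply \<phi> y" for y \<phi>
    unfolding ev_def by (simp add: bounded_linear_Blinfun_apply blinfun.bounded_linear_left)
  have "bounded (ev ` S)"
    by (rule uniform_boundedness) (use assms in \<open>simp add: image_image ev\<close>)
  then obtain B where B: "\<And>y. y \<in> S \<Longrightarrow> norm (ev y) \<le> B"
    by (auto simp: bounded_iff)
  have "norm y \<le> B" if "y \<in> S" for y
  proof -
    obtain \<phi> :: "'a \<Rightarrow>\<^sub>L real" where \<phi>: "norm \<phi> \<le> 1" "\<phi> y = norm y"
      using norming_functional[of y] by blast
    have "norm y \<le> norm (ev y) * norm \<phi>"
      using norm_blinfun[of "ev y" \<phi>] by (simp add: ev \<phi>)
    also have "\<dots> \<le> norm (ev y)"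
      using \<phi>(1) by (simp add: mult_left_le)
    finally show ?thesis using B[OF that] by simp
  qed
  then show ?thesis by (auto simp: bounded_iff)
qed

section \<open>Norm continuity points of weakly continuous maps\<close>
definition weakly_continuous_map :: "'x topology \<Rightarrow> ('x \<Rightarrow> 'e::real_normed_vector) \<Rightarrow> bool"
  where "weakly_continuous_map X f \<longleftrightarrow>
    (\<forall>\<phi> :: 'e \<Rightarrow>\<^sub>L real. continuous_map X euclidean (\<lambda>x. blinfun_apply \<phi> (f x)))"

lemma closedin_functional_le:
  fixes \<phi> :: "'e::real_normed_vector \<Rightarrow>\<^sub>L real"
  assumes "weakly_continuous_map X f"
  shows "closedin X {x \<in> topspace X. blinfun_apply \<phi> (f x) \<le> c}"
proof -
  have "closedin X {x \<in> topspace X. blinfun_apply \<phi> (f x) \<in> {..c}}"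
    using assms by (intro closedin_continuous_map_preimage[of _ euclidean])
      (auto simp: weakly_continuous_map_def)
  then show ?thesis by simp
qed

text \<open>
  Closed balls are intersections of half spaces, hence weakly closed. This is what lets norm
  estimates interact with the Baire category theorem for a map that is only weakly continuous.
\<close>

lemma closedin_norm_le_weakly_continuous:
  fixes f :: "'x \<Rightarrow> 'e::real_normed_vector"
  assumes f: "weakly_continuous_map X f"
  shows "closedin X {x \<in> topspace X. norm (f x - y) \<le> r}"
proof -
  define B where "B = {\<phi> :: 'e \<Rightarrow>\<^sub>L real. norm \<phi> \<le> 1}"
  have "norm z \<le> r \<longleftrightarrow> (\<forall>\<phi>\<in>B. blinfun_apply \<phi> z \<le> r)" for z
  proof
    assume z: "norm z \<le> r"
    show "\<forall>\<phi>\<in>B. blinfun_apply \<phi> z \<le> r"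
    proof
      fix \<phi> assume "\<phi> \<in> B"
      then have "norm \<phi> * norm z \<le> norm z" by (simp add: B_def mult_left_le_one_le)
      then show "blinfun_apply \<phi> z \<le> r"
        using norm_blinfun[of \<phi> z] z by simp
    qed
  next
    assume "\<forall>\<phi>\<in>B. blinfun_apply \<phi> z \<le> r"
    then show "norm z \<le> r"
      using norming_functional[of z] by (metis B_def mem_Collect_eq)
  qed
  moreover have ne: "B \<noteq> {}"
    unfolding B_def by (rule ex_in_conv[THEN iffD1], rule exI[of _ 0]) simp
  ultimately have "{x \<in> topspace X. norm (f x - y) \<le> r} =
      (\<Inter>\<phi>\<in>B. {x \<in> topspace X. blinfun_apply \<phi> (f x) \<le> r + blinfun_apply \<phi> y})"
    by (auto simp: blinfun.diff_right algebra_simps)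
  also have "closedin X \<dots>"
    by (rule closedin_INT) (use ne in \<open>auto intro!: closedin_functional_le f\<close>)
  finally show ?thesis .
qed

lemma span_finite_separable:
  fixes S :: "'a::real_normed_vector set"
  assumes "finite S"
  shows "\<exists>C. countable C \<and> span S \<subseteq> closure C"
  using assms
proof induction
  case empty
  show ?case by (intro exI[of _ "{0}"]) auto
next
  case (insert a S)
  then obtain C where C: "countable C" "span S \<subseteq> closure C" by blast
  define D where "D = (\<lambda>(c, q). c + real_of_rat q *\<^sub>R a) ` (C \<times> UNIV)"
  have "span (insert a S) \<subseteq> closure D"
  proof
    fix x assume "x \<in> span (insert a S)"
    then obtain k where k: "x - k *\<^sub>R a \<in> span S"
      by (auto simp: span_insert)
    show "x \<in> closure D"
      unfolding closure_approachable
    proof safe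
      fix e :: real assume e: "e > 0"
      obtain c where c: "c \<in> C" "dist c (x - k *\<^sub>R a) < e / 2"
        using C k e by (meson closure_approachable half_gt_zero subsetD)
      have "k < k + e / (2 * (norm a + 1))"
        using e by (simp add: add_nonneg_pos)
      then obtain q where q: "k < real_of_rat q" "real_of_rat q < k + e / (2 * (norm a + 1))"
        using of_rat_dense by blast
      have "\<bar>real_of_rat q - k\<bar> * norm a \<le> e / (2 * (norm a + 1)) * norm a"
        using q by (intro mult_right_mono) auto
      also have "\<dots> \<le> e / 2" using e by (simp add: divide_le_eq add_nonneg_pos)
      finally have "norm ((real_of_rat q - k) *\<^sub>R a) \<le> e / 2" by simp
      moreover have "dist (c + real_of_rat q *\<^sub>R a) x
          = norm ((c - (x - k *\<^sub>R a)) + (real_of_rat q - k) *\<^sub>R a)"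
        by (simp add: dist_norm algebra_simps)
      moreover have "norm (c - (x - k *\<^sub>R a)) < e / 2"
        using c(2) by (simp only: dist_norm)
      ultimately have "dist (c + real_of_rat q *\<^sub>R a) x < e"
        using norm_triangle_ineq[of "c - (x - k *\<^sub>R a)" "(real_of_rat q - k) *\<^sub>R a"]
        by linarith
      then show "\<exists>y\<in>D. dist y x < e" using c(1) by (force simp: D_def)
    qed
  qed
  moreover have "countable D" using C by (simp add: D_def)
  ultimately show ?case by blast
qed

text \<open>
  Otherwise one can choose shrinking open sets \<open>V n\<close>, points \<open>v n \<in> V (Suc n)\<close> and functionals
  \<open>\<phi> n\<close> in the unit ball such that \<open>\<phi> n\<close> vanishes at \<open>f (v k)\<close> for \<open>k < n\<close> but exceeds \<open>\<epsilon>\<close> on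
  \<open>f ` V (Suc n)\<close>. By local compactness the points \<open>v n\<close> cluster at some \<open>y\<close>. On the one hand
  \<open>\<phi> n (f y) \<ge> \<epsilon>\<close> for all \<open>n\<close>, so \<open>f y\<close> stays at distance \<open>\<epsilon>\<close> from the subspace where
  \<open>\<phi> n\<close> is eventually zero. On the other hand this subspace contains all \<open>f (v k)\<close>, and \<open>f y\<close> is a
  weak cluster point of them, so no functional separates \<open>f y\<close> from it.
\<close>

lemma open_image_near_finite_dimensional:
  fixes f :: "'x \<Rightarrow> 'e::real_normed_vector"
  assumes lc: "locally_compact_space X" and f: "weakly_continuous_map X f"
    and U: "openin X U" "U \<noteq> {}" and \<epsilon>: "\<epsilon> > 0"
  obtains V F where "openin X V" "V \<noteq> {}" "V \<subseteq> U" "finite F"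
    "\<And>v. v \<in> V \<Longrightarrow> infdist (f v) (span F) \<le> \<epsilon>"
proof (rule ccontr)
  note goal = that
  assume no: "\<not> thesis"
  then have far: "\<exists>v\<in>V. \<epsilon> < infdist (f v) (span F)"
    if "openin X V" "V \<noteq> {}" "V \<subseteq> U" "finite F" for V F
    using goal[OF that] no by (meson not_le)
  obtain x where x: "x \<in> U" using U by blast
  then obtain W K where WK: "openin X W" "compactin X K" "x \<in> W" "W \<subseteq> K"
    using lc U unfolding locally_compact_space_def by (meson openin_subset subsetD)
  define P where "P = (\<lambda>(n::nat) (V, F). openin X V \<and> V \<noteq> {} \<and> V \<subseteq> U \<inter> W \<and> finite (F :: 'e set))"
  define Q where "Q = (\<lambda>(n::nat) (V, F) (V', F'). \<exists>v (\<phi> :: 'e \<Rightarrow>\<^sub>L real).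
      norm \<phi> \<le> 1 \<and> (\<forall>z\<in>F. blinfun_apply \<phi> z = 0) \<and> V' \<subseteq> V \<and> F \<subseteq> F' \<and> v \<in> V' \<and> f v \<in> F' \<and> (\<forall>w\<in>V'. \<epsilon> < blinfun_apply \<phi> (f w)))"
  have "\<exists>S. \<forall>n. P n (S n) \<and> Q n (S n) (S (Suc n))"
  proof (rule dependent_nat_choice)
    have "P 0 (U \<inter> W, {})" using U WK x by (auto simp: P_def)
    then show "\<exists>S. P 0 S" ..
  next
    fix S n assume "P n S"
    then obtain V F where S: "S = (V, F)" and V: "openin X V" "V \<noteq> {}" "V \<subseteq> U \<inter> W" "finite F"
      by (auto simp: P_def)
    obtain v where v: "v \<in> V" "\<epsilon> < infdist (f v) (span F)"
      using far[of V F] V by auto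
    obtain \<phi> :: "'e \<Rightarrow>\<^sub>L real" where \<phi>: "norm \<phi> \<le> 1" "\<And>z. z \<in> span F \<Longrightarrow> \<phi> z = 0" "\<phi> (f v) = infdist (f v) (span F)"
      using functional_infdist[OF subspace_span, of F "f v"] by blast
    define V' where "V' = V - {w \<in> topspace X. \<phi> (f w) \<le> \<epsilon>}"
    have V': "openin X V'"
      unfolding V'_def by (intro openin_diff V closedin_functional_le f)
    have mem: "w \<in> V' \<longleftrightarrow> w \<in> V \<and> \<epsilon> < \<phi> (f w)" for w
      using openin_subset[OF V(1)] by (auto simp: V'_def)
    have "v \<in> V'" using v \<phi> mem by simp
    then have "P (Suc n) (V', insert (f v) F)"
      using V' V mem by (auto simp: P_def)
    moreover have "Q n (V, F) (V', insert (f v) F)"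
      unfolding Q_def split using v \<phi> mem
      by (intro exI[of _ v] exI[of _ \<phi>]) (auto intro: span_base)
    ultimately show "\<exists>S'. P (Suc n) S' \<and> Q n S S'" unfolding S by blast
  qed
  then obtain S where S: "\<And>n. P n (S n)" "\<And>n. Q n (S n) (S (Suc n))" by blast
  define V where "V n = fst (S n)" for n
  define F where "F n = snd (S n)" for n
  have PV: "V n \<subseteq> U \<inter> W" for n
    using S(1)[of n] by (auto simp: P_def V_def split: prod.splits)
  define R where "R n v \<phi> \<longleftrightarrow> norm \<phi> \<le> 1 \<and> (\<forall>z\<in>F n. \<phi> z = 0) \<and> V (Suc n) \<subseteq> V n \<and>
      F n \<subseteq> F (Suc n) \<and> v \<in> V (Suc n) \<and> f v \<in> F (Suc n) \<and> (\<forall>w\<in>V (Suc n). \<epsilon> < \<phi> (f w))"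
    for n v and \<phi> :: "'e \<Rightarrow>\<^sub>L real"
  have "\<forall>n. \<exists>v \<phi>. R n v \<phi>"
    using S(2) by (simp add: Q_def R_def V_def F_def split_beta)
  then obtain v \<phi> where "\<And>n. R n (v n) (\<phi> n)" by metis
  then have \<phi>: "\<And>n. norm (\<phi> n) \<le> 1" "\<And>n z. z \<in> F n \<Longrightarrow> \<phi> n z = 0" "\<And>n w. w \<in> V (Suc n) \<Longrightarrow> \<epsilon> < \<phi> n (f w)"
    and V: "\<And>n. V (Suc n) \<subseteq> V n" and F: "\<And>n. F n \<subseteq> F (Suc n)"
    and v: "\<And>n. v n \<in> V (Suc n)" "\<And>n. f (v n) \<in> F (Suc n)"
    unfolding R_def by blast+
  have Vanti: "V m \<subseteq> V n" if "n \<le> m" for m n using lift_Suc_antimono_le[of V, OF V that] .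
  have Fmono: "F n \<subseteq> F m" if "n \<le> m" for m n using lift_Suc_mono_le[of F, OF F that] .
  have vK: "v n \<in> K" for n using v(1) PV WK by blast
  define C where "C n = subtopology X K closure_of (v ` {n..})" for n
  have topK: "topspace (subtopology X K) = K"
    using compactin_subset_topspace[OF WK(2)] by (rule topspace_subtopology_subset)
  have "(\<Inter>n. C n) \<noteq> {}"
  proof (rule compact_space_imp_nest)
    show "compact_space (subtopology X K)" using WK(2) by (simp add: compactin_subspace)
    show "closedin (subtopology X K) (C n)" for n by (simp add: C_def)
    have "v ` {n..} \<subseteq> C n" for n
      unfolding C_def by (rule closure_of_subset) (use vK in \<open>simp only: topK image_subset_iff\<close>, blast)
    then show "C n \<noteq> {}" for n by blast
    show "decseq C"
      unfolding C_def decseq_def by (intro allI impI closure_of_mono image_mono) simp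
  qed
  then obtain y where y: "\<And>n. y \<in> C n" by blast
  have cluster: "y \<in> T" if "closedin X T" "\<And>k. k \<ge> n \<Longrightarrow> v k \<in> T" for T n
  proof -
    have "C n \<subseteq> X closure_of (v ` {n..})"
      unfolding C_def by (rule closure_of_subtopology_subset)
    also have "\<dots> \<subseteq> T" by (rule closure_of_minimal) (use that in auto)
    finally show ?thesis using y by blast
  qed
  have vX: "v k \<in> topspace X" for k
    using vK WK(2) compactin_subset_topspace by blast
  have \<phi>y: "\<epsilon> \<le> \<phi> n (f y)" for n
  proof -
    have "y \<in> {w \<in> topspace X. (- \<phi> n) (f w) \<le> - \<epsilon>}"
    proof (rule cluster[OF closedin_functional_le[OF f]])
      fix k assume "n \<le> k"
      then have "v k \<in> V (Suc n)" using v(1)[of k] Vanti[of "Suc n" "Suc k"] by auto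
      then show "v k \<in> {w \<in> topspace X. (- \<phi> n) (f w) \<le> - \<epsilon>}"
        using \<phi>(3)[of "v k" n] vX[of k] by (simp add: blinfun.minus_left)
    qed
    then show ?thesis by (simp add: blinfun.minus_left)
  qed
  \<comment> \<open>A subspace containing every \<open>f (v k)\<close>, more convenient than their span.\<close>
  define L where "L = {z. eventually (\<lambda>n. \<phi> n z = 0) sequentially}"
  have L: "subspace L"
  proof (rule subspaceI)
    fix a b assume "a \<in> L" "b \<in> L"
    then show "a + b \<in> L"
      unfolding L_def mem_Collect_eq by eventually_elim (simp add: blinfun.add_right)
  next
    fix c a assume "a \<in> L"
    then show "c *\<^sub>R a \<in> L"
      unfolding L_def mem_Collect_eq by eventually_elim (simp add: blinfun.scaleR_right)
  qed (simp add: L_def)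
  have "\<epsilon> \<le> infdist (f y) L"
  proof -
    have "\<epsilon> \<le> dist (f y) z" if "z \<in> L" for z
    proof -
      have "\<exists>N. \<forall>n\<ge>N. \<phi> n z = 0" using that by (simp add: L_def eventually_sequentially)
      then obtain n where "\<phi> n z = 0" by blast
      then have "\<epsilon> \<le> \<phi> n (f y - z)" using \<phi>y[of n] by (simp add: blinfun.diff_right)
      also have "\<dots> \<le> norm (\<phi> n) * norm (f y - z)"
        using norm_blinfun[of "\<phi> n" "f y - z"] by simp
      also have "\<dots> \<le> norm (f y - z)" using \<phi>(1) by (simp add: mult_left_le_one_le)
      finally show ?thesis by (simp add: dist_norm)
    qed
    then show ?thesis
      using subspace_0[OF L] by (subst infdist_notempty) (auto intro: cINF_greatest)
  qed
  moreover obtain \<psi> :: "'e \<Rightarrow>\<^sub>L real" where \<psi>: "\<And>z. z \<in> L \<Longrightarrow> \<psi> z = 0" "\<psi> (f y) = infdist (f y) L"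
    using functional_infdist[OF L, of "f y"] by blast
  moreover have "y \<in> {w \<in> topspace X. \<psi> (f w) \<le> 0}"
  proof (rule cluster[of _ 0, OF closedin_functional_le[OF f]])
    fix k
    have "\<phi> n (f (v k)) = 0" if "n \<ge> Suc k" for n
      using v(2)[of k] Fmono[OF that] \<phi>(2) by blast
    then have "f (v k) \<in> L" by (auto simp: L_def eventually_sequentially)
    then show "v k \<in> {w \<in> topspace X. \<psi> (f w) \<le> 0}" using vX \<psi> by simp
  qed
  ultimately show False using \<epsilon> by auto
qed

text \<open>
  A set close to a finite-dimensional space is covered by countably many small closed balls, since
  that space is separable. Their preimages are closed, so by Baire one of them has interior.
\<close>

lemma open_image_norm_small:
  fixes f :: "'x \<Rightarrow> 'e::real_normed_vector"
  assumes lc: "locally_compact_space X" and reg: "regular_space X"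
    and f: "weakly_continuous_map X f"
    and U: "openin X U" "U \<noteq> {}" and \<epsilon>: "\<epsilon> > 0"
  obtains V where "openin X V" "V \<noteq> {}" "V \<subseteq> U" "\<And>v w. v \<in> V \<Longrightarrow> w \<in> V \<Longrightarrow> norm (f v - f w) \<le> \<epsilon>"
proof -
  obtain V F where V: "openin X V" "V \<noteq> {}" "V \<subseteq> U" "finite F"
    and near: "\<And>v. v \<in> V \<Longrightarrow> infdist (f v) (span F) \<le> \<epsilon> / 4"
    using open_image_near_finite_dimensional[OF lc f U, of "\<epsilon> / 4"] \<epsilon> by auto
  obtain C where C: "countable C" "span F \<subseteq> closure C"
    using span_finite_separable[OF V(4)] by blast
  define Y where "Y = subtopology X V"
  have topY: "topspace Y = V" using openin_subset[OF V(1)] by (auto simp: Y_def)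
  define A where "A c = {v \<in> topspace X. norm (f v - c) \<le> \<epsilon> / 2} \<inter> V" for c
  have Y: "locally_compact_space Y \<and> regular_space Y"
    unfolding Y_def by (intro conjI locally_compact_space_open_subset regular_space_subtopology V lc reg disjI2)
  have cl: "closedin Y (A c)" for c
    unfolding Y_def A_def closedin_subtopology
    using closedin_norm_le_weakly_continuous[OF f] by blast
  have "V \<subseteq> \<Union> (A ` C)"
  proof
    fix v assume v: "v \<in> V"
    have "C \<noteq> {}" using C span_0[of F] by auto
    have "infdist (f v) C = infdist (f v) (closure C)"
      by (simp add: infdist_eq_setdist)
    also have "\<dots> \<le> infdist (f v) (span F)"
      by (rule infdist_mono[OF C(2)]) (use span_0[of F] in blast)
    also have "\<dots> < \<epsilon> / 2" using near[OF v] \<epsilon> by simp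
    finally have "Inf (dist (f v) ` C) < \<epsilon> / 2"
      by (simp add: infdist_notempty[OF \<open>C \<noteq> {}\<close>])
    then obtain c where "c \<in> C" "dist (f v) c < \<epsilon> / 2"
      using cInf_lessD[of "dist (f v) ` C" "\<epsilon> / 2"] \<open>C \<noteq> {}\<close> by blast
    then show "v \<in> \<Union> (A ` C)"
      using v openin_subset[OF V(1)] by (intro UN_I[of c]) (auto simp: A_def dist_norm)
  qed
  then have "\<Union> (A ` C) = topspace Y" by (auto simp: A_def topY)
  then have int: "Y interior_of (\<Union> (A ` C)) = V" by (metis interior_of_topspace topY)
  have "\<exists>c. Y interior_of (A c) \<noteq> {}"
  proof (rule ccontr)
    assume "\<not> ?thesis"
    then have "Y interior_of (\<Union> (A ` C)) = {}"
      using Y C(1) cl by (intro Baire_category_alt) auto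
    then show False using int V(2) by simp
  qed
  then obtain c where c: "Y interior_of (A c) \<noteq> {}" ..
  have sub: "Y interior_of (A c) \<subseteq> A c" by (rule interior_of_subset)
  show thesis
  proof
    show "openin X (Y interior_of (A c))"
      using V(1) unfolding Y_def by (rule openin_trans_full[OF openin_interior_of])
    show "Y interior_of (A c) \<subseteq> U" using sub V(3) by (auto simp: A_def)
    show "norm (f v - f w) \<le> \<epsilon>" if "v \<in> Y interior_of (A c)" "w \<in> Y interior_of (A c)" for v w
    proof -
      have "norm (f v - c) \<le> \<epsilon> / 2" "norm (f w - c) \<le> \<epsilon> / 2"
        using that sub by (auto simp: A_def)
      then show ?thesis
        using norm_triangle_ineq4[of "f v - c" "f w - c"] by simp
    qed
  qed (use c in auto)
qed

text \<open>
  By the preceding lemma, the open sets \<open>G n\<close> of points with a neighbourhood of image diameter at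
  most \<open>1 / (n + 1)\<close> are dense, so by Baire their intersection meets \<open>U\<close>. The range of \<open>f\<close> need not
  be separable; this is a theorem of Namioka.
\<close>

theorem weakly_continuous_norm_continuity_point:
  fixes f :: "'x \<Rightarrow> 'e::real_normed_vector"
  assumes lc: "locally_compact_space X" and reg: "regular_space X"
    and f: "weakly_continuous_map X f"
    and U: "openin X U" "U \<noteq> {}"
  obtains x where "x \<in> U" "limitin euclidean f (f x) (atin X x)"
proof -
  define small where "small n V \<longleftrightarrow> (\<forall>v\<in>V. \<forall>w\<in>V. norm (f v - f w) \<le> inverse (real (Suc n)))" for n V
  define G where "G n = \<Union> {V. openin X V \<and> small n V}" for n
  have "X closure_of \<Inter> (range G) = topspace X"
  proof (rule Baire_category)
    show "completely_metrizable_space X \<or> locally_compact_space X \<and> regular_space X"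
      using lc reg by simp
    fix T assume "T \<in> range G"
    then obtain n where T: "T = G n" by blast
    have "X closure_of (G n) = topspace X"
      unfolding dense_intersects_open
    proof safe
      fix W w assume W: "openin X W" "w \<in> W" "G n \<inter> W = {}"
      have "W \<noteq> {}" "inverse (real (Suc n)) > 0" using W(2) by auto
      then obtain V where V: "openin X V" "V \<noteq> {}" "V \<subseteq> W" "small n V"
        using open_image_norm_small[OF lc reg f W(1)] unfolding small_def by metis
      then have "V \<subseteq> G n" by (auto simp: G_def)
      then show "w \<in> {}" using V W(3) by blast
    qed
    moreover have "openin X (G n)" unfolding G_def by (auto intro: openin_Union)
    ultimately show "openin X T \<and> X closure_of T = topspace X" by (simp add: T)
  qed simp
  then have "\<Inter> (range G) \<inter> U \<noteq> {}"
    using U unfolding dense_intersects_open by blast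
  then obtain x where x: "x \<in> U" "\<And>n. x \<in> G n" by blast
  have "limitin euclidean f (f x) (atin X x)"
    unfolding limitin_canonical_iff tendsto_iff
  proof safe
    fix e :: real assume "e > 0"
    then obtain n where n: "inverse (real (Suc n)) < e" using reals_Archimedean by blast
    obtain V where V: "openin X V" "small n V" "x \<in> V" using x(2)[of n] by (auto simp: G_def)
    show "eventually (\<lambda>w. dist (f w) (f x) < e) (atin X x)"
      unfolding eventually_atin using V n
      by (intro disjI2 conjI exI[of _ V]) (auto simp: small_def dist_norm intro: le_less_trans)
  qed
  with x(1) that show thesis by blast
qed

section \<open>Weak operator topologies and functionals\<close>

lemma openin_weak_operator_subbasis:
  assumes "\<phi> \<in> \<Phi>" "open U"
  shows "openin (weak_operator_topology_wrt \<Phi>) {A. blinfun_apply \<phi> (blinfun_apply A x) \<in> U}"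
  unfolding weak_operator_topology_wrt_def
  by (rule topology_generated_by_Basis) (use assms in blast)

lemma continuous_map_weak_operator_functional:
  fixes \<phi> :: "'b::real_normed_vector \<Rightarrow>\<^sub>L 'k::real_normed_vector"
  assumes T: "continuous_map X (weak_operator_topology_wrt \<Phi>) T" and \<phi>: "\<phi> \<in> \<Phi>"
  shows "continuous_map X euclidean (\<lambda>t. blinfun_apply \<phi> (blinfun_apply (T t) x))"
  unfolding continuous_map_def
proof (intro conjI allI impI)
  fix U :: "'k set" assume "openin euclidean U"
  then have "openin X {t \<in> topspace X. T t \<in> {A. blinfun_apply \<phi> (blinfun_apply A x) \<in> U}}"
    using \<phi> by (intro openin_continuous_map_preimage[OF T] openin_weak_operator_subbasis) simp_all
  then show "openin X {t \<in> topspace X. blinfun_apply \<phi> (blinfun_apply (T t) x) \<in> U}" by simp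
qed simp

lemma weakly_continuous_map_real_weak_operator:
  assumes "continuous_map X real_weak_operator_topology T"
  shows "weakly_continuous_map X (\<lambda>t. blinfun_apply (T t) x)"
  using assms unfolding weakly_continuous_map_def real_weak_operator_topology_def
  by (auto intro: continuous_map_weak_operator_functional)

text \<open>
  Because a real functional is the real part of a complex-linear one, continuity for the complex
  weak operator topology gives weak continuity of orbits in the real sense, and only real
  functionals have to be considered afterwards.
\<close>

lemma complex_functional_with_Re:
  fixes \<phi> :: "'a::complex_normed_vector \<Rightarrow>\<^sub>L real"
  obtains \<Phi> :: "'a \<Rightarrow>\<^sub>L complex" where "complex_linear \<Phi>" "\<And>x. Re (\<Phi> x) = \<phi> x"
proof -
  define f where "f x = Complex (\<phi> x) (- \<phi> (\<i> *\<^sub>C x))" for x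
  have add: "f (x + y) = f x + f y" for x y
    by (simp add: f_def scaleC_add_right blinfun.add_right complex_eq_iff)
  have real: "(c::real) *\<^sub>R x = complex_of_real c *\<^sub>C x" for c and x :: 'a
    by (simp add: scaleC_of_real)
  have scaleC: "f (c *\<^sub>C x) = c * f x" for c x
  proof -
    have lin: "\<phi> (c *\<^sub>C y) = Re c * \<phi> y + Im c * \<phi> (\<i> *\<^sub>C y)" for y
    proof -
      have "c *\<^sub>C y = Re c *\<^sub>R y + Im c *\<^sub>R (\<i> *\<^sub>C y)"
        by (subst complex_eq[of c])
          (simp add: real scaleC_add_left scaleC_scaleC mult.commute)
      then show ?thesis by (simp add: blinfun.add_right blinfun.scaleR_right)
    qed
    have "\<i> *\<^sub>C (\<i> *\<^sub>C x) = - x"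
      using real[of "-1" x] by (simp add: scaleC_scaleC)
    moreover have "\<i> *\<^sub>C (c *\<^sub>C x) = c *\<^sub>C (\<i> *\<^sub>C x)" by (simp add: scaleC_scaleC mult.commute)
    ultimately have "\<phi> (\<i> *\<^sub>C (c *\<^sub>C x)) = Re c * \<phi> (\<i> *\<^sub>C x) - Im c * \<phi> x"
      by (simp only: lin blinfun.minus_right)
    then show ?thesis
      by (simp only: f_def lin complex_eq_iff) (simp add: algebra_simps)
  qed
  have bl: "bounded_linear f"
  proof (rule bounded_linear_intro[of f "2 * norm \<phi>"])
    show "f (x + y) = f x + f y" for x y by (rule add)
    show "f (c *\<^sub>R x) = c *\<^sub>R f x" for c x
      by (simp add: real scaleC scaleR_conv_of_real)
    show "norm (f x) \<le> norm x * (2 * norm \<phi>)" for x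
    proof -
      have "norm (f x) \<le> \<bar>\<phi> x\<bar> + \<bar>\<phi> (\<i> *\<^sub>C x)\<bar>"
        using cmod_le[of "f x"] by (simp add: f_def)
      also have "\<dots> \<le> norm \<phi> * norm x + norm \<phi> * norm (\<i> *\<^sub>C x)"
        using norm_blinfun[of \<phi>] by (intro add_mono) simp_all
      finally show ?thesis by (simp add: norm_scaleC)
    qed
  qed
  show thesis
  proof
    show "complex_linear (Blinfun f)"
      using scaleC by (simp add: complex_linear_def bounded_linear_Blinfun_apply[OF bl] scaleC_complex_def)
    show "Re (Blinfun f x) = \<phi> x" for x
      by (simp add: bounded_linear_Blinfun_apply[OF bl] f_def)
  qed
qed

lemma weakly_continuous_map_complex_weak_operator:
  fixes T :: "'x \<Rightarrow> 'a::complex_normed_vector \<Rightarrow>\<^sub>L 'b::complex_normed_vector"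
  assumes "continuous_map X complex_weak_operator_topology T"
  shows "weakly_continuous_map X (\<lambda>t. blinfun_apply (T t) x)"
  unfolding weakly_continuous_map_def
proof
  fix \<phi> :: "'b \<Rightarrow>\<^sub>L real"
  obtain \<Phi> :: "'b \<Rightarrow>\<^sub>L complex" where \<Phi>: "complex_linear \<Phi>" "\<And>x. Re (\<Phi> x) = \<phi> x"
    using complex_functional_with_Re[of \<phi>] by blast
  have "continuous_map X euclidean (\<lambda>t. \<Phi> (T t x))"
    using assms \<Phi>(1) unfolding complex_weak_operator_topology_def
    by (auto intro: continuous_map_weak_operator_functional)
  then have "continuous_map X euclidean (Re \<circ> (\<lambda>t. \<Phi> (T t x)))"
    by (rule continuous_map_compose) (simp add: continuous_on_Re)
  then show "continuous_map X euclidean (\<lambda>t. \<phi> (T t x))"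
    by (simp add: o_def \<Phi>)
qed

text \<open>
  A compact neighbourhood has weakly compact, hence weakly bounded, orbits. Uniform boundedness is
  applied twice: in the dual space to bound each orbit in norm, and then to the operators.
\<close>

lemma locally_bounded_if_weakly_continuous:
  fixes T :: "'x \<Rightarrow> 'a::banach \<Rightarrow>\<^sub>L 'b::real_normed_vector"
  assumes lc: "locally_compact_space X" and t: "t \<in> topspace X"
    and T: "\<And>x. weakly_continuous_map X (\<lambda>t. blinfun_apply (T t) x)"
  obtains U where "openin X U" "t \<in> U" "bounded (T ` U)"
proof -
  obtain U K where U: "openin X U" "compactin X K" "t \<in> U" "U \<subseteq> K"
    using lc t unfolding locally_compact_space_def by meson
  have "bounded (T ` K)"
  proof (rule uniform_boundedness)
    fix x
    have "bounded ((\<lambda>t. blinfun_apply (T t) x) ` K)"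
    proof (rule bounded_if_weakly_bounded)
      fix \<phi> :: "'b \<Rightarrow>\<^sub>L real"
      have "compactin euclidean ((\<lambda>t. blinfun_apply \<phi> (blinfun_apply (T t) x)) ` K)"
        using T[of x] U(2) unfolding weakly_continuous_map_def by (blast intro: image_compactin)
      then show "bounded (blinfun_apply \<phi> ` (\<lambda>t. blinfun_apply (T t) x) ` K)"
        by (simp add: image_image compact_imp_bounded)
    qed
    then show "bounded ((\<lambda>A. blinfun_apply A x) ` T ` K)" by (simp add: image_image)
  qed
  then show thesis using U that by (meson bounded_subset image_mono)
qed

section \<open>Vectors with norm-continuous orbits\<close>

definition continuity_vectors ::
    "('x::topological_space \<Rightarrow> 'a::real_normed_vector \<Rightarrow>\<^sub>L 'b::real_normed_vector) \<Rightarrow> 'a set"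
  where "continuity_vectors T = {x. continuous_on UNIV (\<lambda>t. blinfun_apply (T t) x)}"

lemma subspace_continuity_vectors: "subspace (continuity_vectors T)"
  by (rule subspaceI)
    (auto simp: continuity_vectors_def blinfun.add_right blinfun.scaleR_right intro!: continuous_intros)

text \<open>
  On a neighbourhood where the operators are bounded, the orbit of a limit of vectors is a uniform
  limit of their orbits.
\<close>

lemma closed_continuity_vectors:
  fixes T :: "'x::topological_space \<Rightarrow> 'a::real_normed_vector \<Rightarrow>\<^sub>L 'b::real_normed_vector"
  assumes bdd: "\<And>t. \<exists>U. open U \<and> t \<in> U \<and> bounded (T ` U)"
  shows "closed (continuity_vectors T)"
proof -
  have "x \<in> continuity_vectors T" if x: "x \<in> closure (continuity_vectors T)" for x
  proof -
    have "((\<lambda>t. blinfun_apply (T t) x) \<longlongrightarrow> blinfun_apply (T t) x) (at t)" for t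
      unfolding tendsto_iff
    proof safe
      fix e :: real assume e: "e > 0"
      obtain U B where U: "open U" "t \<in> U" and B: "\<And>s. s \<in> U \<Longrightarrow> norm (T s) \<le> B" "B > 0"
        using bdd[of t] by (auto simp: bounded_pos)
      obtain z where z: "z \<in> continuity_vectors T" "dist z x < e / (3 * B)"
        using x e B(2) closure_approachable[of x] by (meson divide_pos_pos mult_pos_pos zero_less_numeral)
      have close: "dist (blinfun_apply (T s) x) (blinfun_apply (T s) z) < e / 3" if "s \<in> U" for s
      proof -
        have "dist (blinfun_apply (T s) x) (blinfun_apply (T s) z) \<le> norm (T s) * norm (x - z)"
          using norm_blinfun[of "T s" "x - z"] by (simp add: dist_norm blinfun.diff_right)
        also have "\<dots> \<le> B * dist z x"
          using B that by (intro mult_mono) (auto simp: dist_norm norm_minus_commute)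
        also have "\<dots> < e / 3" using z(2) B(2) by (simp add: field_simps)
        finally show ?thesis .
      qed
      have "eventually (\<lambda>s. dist (blinfun_apply (T s) z) (blinfun_apply (T t) z) < e / 3) (at t)"
        using z(1) e by (intro tendstoD) (simp_all add: continuity_vectors_def continuous_on_def)
      moreover have "eventually (\<lambda>s. s \<in> U) (at t)"
        using U by (intro eventually_at_in_open')
      ultimately show "eventually (\<lambda>s. dist (blinfun_apply (T s) x) (blinfun_apply (T t) x) < e) (at t)"
      proof eventually_elim
        case (elim s)
        then show ?case
          using close[of s] close[OF U(2)]
            dist_triangle[of "blinfun_apply (T s) x" "blinfun_apply (T t) x" "blinfun_apply (T s) z"]
            dist_triangle[of "blinfun_apply (T s) z" "blinfun_apply (T t) x" "blinfun_apply (T t) z"]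
          by (simp add: dist_commute)
      qed
    qed
    then show ?thesis by (simp add: continuity_vectors_def continuous_on_def)
  qed
  then show ?thesis using closure_subset_eq by blast
qed

text \<open>
  The orbit of \<open>T u x\<close> at \<open>s\<close> is the orbit of \<open>x\<close> at \<open>s * u\<close>. For \<open>s\<close> near \<open>t\<close>, the group element
  \<open>- \<iota> t + \<iota> s + \<iota> u\<close> is near \<open>\<iota> u\<close> and therefore, \<open>\<iota> u\<close> being interior, equals \<open>\<iota> v\<close> for some \<open>v\<close>
  in the monoid. So \<open>s * u = t * v\<close>, and continuity at \<open>\<iota> u\<close> is transported by the bounded operator
  \<open>T t\<close>. Thus a single continuity point of one orbit yields an orbit that is continuous everywhere,
  although \<open>t\<close> need not be invertible in the monoid.
\<close>

lemma continuity_vector_if_continuous_at_interior: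
  fixes \<iota> :: "'m::topological_monoid_mult \<Rightarrow> 'g::{topological_group_add, t2_space}"
    and T :: "'m \<Rightarrow> 'e::real_normed_vector \<Rightarrow>\<^sub>L 'e"
  assumes T: "operator_semigroup T"
    and inj: "inj \<iota>" and cont: "continuous_on UNIV \<iota>" and hom: "\<And>s t. \<iota> (s * t) = \<iota> s + \<iota> t"
    and u: "\<iota> u \<in> interior (range \<iota>)"
    and f: "isCont (\<lambda>g. blinfun_apply (T (inv \<iota> g)) x) (\<iota> u)"
  shows "blinfun_apply (T u) x \<in> continuity_vectors T"
proof -
  define f where "f g = blinfun_apply (T (inv \<iota> g)) x" for g
  have mult: "blinfun_apply (T (s * t)) y = blinfun_apply (T s) (blinfun_apply (T t) y)" for s t y
    using T by (simp add: operator_semigroup_def)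
  have "((\<lambda>s. blinfun_apply (T s) (blinfun_apply (T u) x)) \<longlongrightarrow>
      blinfun_apply (T t) (blinfun_apply (T u) x)) (at t)" for t
  proof -
    define w where "w s = - \<iota> t + (\<iota> s + \<iota> u)" for s
    have "(\<iota> \<longlongrightarrow> \<iota> t) (at t)" using cont by (simp add: continuous_on_def)
    then have "((\<lambda>s. - \<iota> t + (\<iota> s + \<iota> u)) \<longlongrightarrow> - \<iota> t + (\<iota> t + \<iota> u)) (at t)"
by (intro tendsto_intros)
    then have w: "(w \<longlongrightarrow> \<iota> u) (at t)"
      by (simp add: w_def[abs_def] add.assoc[symmetric])
    have "((\<lambda>s. f (w s)) \<longlongrightarrow> f (\<iota> u)) (at t)"
      using f w unfolding f_def by (rule isCont_tendsto_compose)
    then have lim: "((\<lambda>s. blinfun_apply (T t) (f (w s))) \<longlongrightarrow> blinfun_apply (T t) (f (\<iota> u))) (at t)"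
      by (intro tendsto_intros)
    have "eventually (\<lambda>s. w s \<in> interior (range \<iota>)) (at t)"
      using w u by (intro topological_tendstoD) auto
    then have "eventually (\<lambda>s. blinfun_apply (T t) (f (w s)) = blinfun_apply (T s) (blinfun_apply (T u) x)) (at t)"
    proof eventually_elim
      case (elim s)
      then obtain v where v: "\<iota> v = w s" using interior_subset by (metis imageE subsetD)
      then have "\<iota> (t * v) = \<iota> (s * u)" by (simp add: hom w_def add.assoc[symmetric])
      then have "t * v = s * u" using inj by (simp add: inj_eq)
      then have "blinfun_apply (T t) (blinfun_apply (T v) x) = blinfun_apply (T s) (blinfun_apply (T u) x)"
        by (simp flip: mult)
      then show ?case by (simp add: f_def inj flip: v)
    qed
    then show ?thesis
      using Lim_transform_eventually[OF lim] by (simp add: f_def inj)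
  qed
  then show ?thesis by (simp add: continuity_vectors_def continuous_on_def)
qed

section \<open>Strong continuity\<close>

text \<open>
  If some \<open>x\<close> were outside the closed subspace \<open>D\<close> of vectors with norm-continuous orbits, a
  functional would vanish on \<open>D\<close> and be positive at \<open>x\<close>. Weak continuity at the identity keeps it
  positive at \<open>T u x\<close> for \<open>u\<close> near \<open>1\<close>. Positivity in the identity supplies a nonempty open set of
  such \<open>u\<close> inside the monoid, and some \<open>u\<close> in it is a norm continuity point of the orbit of \<open>x\<close>;
  but then \<open>T u x\<close> lies in \<open>D\<close>.
\<close>

theorem weakly_continuous_semigroup_strongly_continuous:
  fixes \<iota> :: "'m::topological_monoid_mult \<Rightarrow> 'g::{topological_group_add, t2_space}"
    and T :: "'m \<Rightarrow> 'e::banach \<Rightarrow>\<^sub>L 'e"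
  assumes lc: "locally_compact_space (euclidean :: 'g topology)"
    and emb: "closed_monoid_embedding \<iota>"
    and pos: "positive_in_identity (range \<iota>)"
    and T: "operator_semigroup T"
    and weak: "\<And>x. weakly_continuous_map euclidean (\<lambda>t. blinfun_apply (T t) x)"
  shows "continuous_map euclidean strong_operator_topology T"
proof -
  have hom: "\<And>s t. \<iota> (s * t) = \<iota> s + \<iota> t" and one: "\<iota> 1 = 0"
    and emb\<iota>: "embedding_map euclidean euclidean \<iota>" and cl: "closed (range \<iota>)"
    using emb by (auto simp: closed_monoid_embedding_def)
  have homeo: "homeomorphic_map euclidean (top_of_set (range \<iota>)) \<iota>"
    using emb\<iota> by (simp add: embedding_map_def)
  have inj: "inj \<iota>" using homeomorphic_imp_injective_map[OF homeo] by simp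
  have cont: "continuous_on UNIV \<iota>"
    using homeomorphic_imp_continuous_map[OF homeo] by (simp add: continuous_map_in_subtopology)
  have inv_cont: "continuous_map (top_of_set (range \<iota>)) euclidean (inv \<iota>)"
  proof -
    obtain h where "homeomorphic_maps euclidean (top_of_set (range \<iota>)) \<iota> h"
      using homeo homeomorphic_map_maps by blast
    then have h: "continuous_map (top_of_set (range \<iota>)) euclidean h" "\<And>t. h (\<iota> t) = t"
      by (auto simp: homeomorphic_maps_def)
    show ?thesis
      by (rule continuous_map_eq[OF h(1)]) (auto simp: inj h(2))
  qed
  have lcM: "locally_compact_space (euclidean :: 'm topology)"
  proof -
    have "locally_compact_space (top_of_set (range \<iota>))"
      using lc cl by (intro locally_compact_space_closed_subset) simp_all
    then show ?thesis
      using homeo homeomorphic_map_imp_homeomorphic_space homeomorphic_locally_compact_space by blast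
  qed
  define D where "D = continuity_vectors T"
  have D: "subspace D" unfolding D_def by (rule subspace_continuity_vectors)
  have clD: "closed D"
    unfolding D_def
  proof (rule closed_continuity_vectors)
    fix t :: 'm
    have "t \<in> topspace euclidean" by simp
    then obtain U where "openin euclidean U" "t \<in> U" "bounded (T ` U)"
      by (rule locally_bounded_if_weakly_continuous[OF lcM _ weak])
    then show "\<exists>U. open U \<and> t \<in> U \<and> bounded (T ` U)" by (intro exI[of _ U]) simp
  qed
  define W where "W = interior (range \<iota>)"
  define X where "X = top_of_set W"
  have oW: "open W" by (simp add: W_def)
  have reg: "regular_space (euclidean :: 'g topology)"
  proof (rule locally_compact_Hausdorff_imp_regular_space[OF lc])
    show "Hausdorff_space (euclidean :: 'g topology)"
      unfolding Hausdorff_space_def using hausdorff by (fastforce simp: disjnt_def)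
  qed
  have X: "locally_compact_space X" "regular_space X"
    unfolding X_def using lc reg oW
    by (auto intro: locally_compact_space_open_subset regular_space_subtopology)
  have "x \<in> D" for x
  proof (rule ccontr)
    assume "x \<notin> D"
    then have "infdist x D > 0"
      using infdist_pos_not_in_closed[OF clD] subspace_0[OF D] by blast
    moreover obtain \<phi> :: "'e \<Rightarrow>\<^sub>L real" where
      "norm \<phi> \<le> 1" "\<And>z. z \<in> D \<Longrightarrow> \<phi> z = 0" "\<phi> x = infdist x D"
      using functional_infdist[OF D, of x] by blast
    ultimately have \<phi>: "\<And>z. z \<in> D \<Longrightarrow> \<phi> z = 0" "\<phi> x > 0" by simp_all
    have wk: "weakly_continuous_map X (\<lambda>g. blinfun_apply (T (inv \<iota> g)) x)"
      unfolding weakly_continuous_map_def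
    proof
      fix \<psi> :: "'e \<Rightarrow>\<^sub>L real"
      have "continuous_map X euclidean (inv \<iota>)"
        unfolding X_def using inv_cont by (rule continuous_map_from_subtopology_mono)
          (auto simp: W_def interior_subset)
      moreover have "continuous_map euclidean euclidean (\<lambda>t. \<psi> (T t x))"
        using weak by (simp add: weakly_continuous_map_def)
      ultimately show "continuous_map X euclidean (\<lambda>g. \<psi> (T (inv \<iota> g) x))"
        by (rule continuous_map_compose[unfolded o_def])
    qed
    define S where "S = {t. \<phi> (T t x) > 0}"
    have "continuous_on UNIV (\<lambda>t. \<phi> (T t x))"
      using weak by (simp add: weakly_continuous_map_def)
    then have "open S" unfolding S_def by (rule open_Collect_less[OF continuous_on_const])
    then have "openin (top_of_set (range \<iota>)) (\<iota> ` S)"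
      using homeomorphic_map_openness[OF homeo, of S] by simp
    then obtain U where U: "open U" "\<iota> ` S = range \<iota> \<inter> U"
      by (auto simp: openin_open)
    have "1 \<in> S" using T \<phi>(2) by (simp add: S_def operator_semigroup_def)
    then have "0 \<in> U" using U one by (metis IntD2 imageI)
    then have ne: "interior (U \<inter> range \<iota>) \<noteq> {}"
      using pos U(1) unfolding positive_in_identity_def by (metis interior_open)
    have op: "openin X (interior (U \<inter> range \<iota>))"
      unfolding X_def W_def
      by (simp only: openin_open_eq[OF open_interior]) (simp add: open_Int)
    obtain g where g: "g \<in> interior (U \<inter> range \<iota>)"
      "limitin euclidean (\<lambda>g. blinfun_apply (T (inv \<iota> g)) x) (blinfun_apply (T (inv \<iota> g)) x) (atin X g)"
      using weakly_continuous_norm_continuity_point[OF X wk op ne] by blast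
    have gW: "g \<in> W" using g(1) interior_mono[of "U \<inter> range \<iota>" "range \<iota>"] by (auto simp: W_def)
    have "g \<in> \<iota> ` S" using g(1) interior_subset U(2) by blast
    then obtain u where u: "u \<in> S" "\<iota> u = g" by blast
    have "eventually P (at g)" if P: "eventually P (atin X g)" for P
    proof -
      obtain V where "openin X V" "g \<in> V" "\<forall>h\<in>V - {g}. P h"
        using P gW unfolding eventually_atin X_def by auto
      then show ?thesis
        unfolding X_def eventually_at_topological openin_open_eq[OF oW] by blast
    qed
    then have "at g \<le> atin X g" by (auto simp: le_filter_def)
    then have "isCont (\<lambda>g. blinfun_apply (T (inv \<iota> g)) x) g"
      using g(2) unfolding isCont_def limitin_canonical_iff by (rule tendsto_mono)
    then have "blinfun_apply (T u) x \<in> D"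
      unfolding D_def using gW u
      by (intro continuity_vector_if_continuous_at_interior[OF T inj cont hom]) (auto simp: W_def)
    then show False using \<phi>(1) u(1) by (auto simp: S_def)
  qed
  then have "continuous_on UNIV (\<lambda>t. blinfun_apply (T t) x)" for x
    by (simp add: D_def continuity_vectors_def)
  then show ?thesis
    by (simp add: continuous_on_strong_operator_topo_iff_coordinatewise)
qed

theorem theoremA8:
  fixes \<iota> :: "'m::topological_monoid_mult \<Rightarrow> 'g::{topological_group_add, t2_space}"
  assumes "locally_compact_space (euclidean :: 'g topology)"
    and "closed_monoid_embedding \<iota>"
    and "positive_in_identity (range \<iota>)"
  shows "(\<forall>T :: 'm \<Rightarrow> ('e::banach \<Rightarrow>\<^sub>L 'e).
            operator_semigroup T \<longrightarrow>
            continuous_map euclidean real_weak_operator_topology T \<longrightarrow>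
            continuous_map euclidean strong_operator_topology T) \<and>
         (\<forall>T :: 'm \<Rightarrow> ('f::cbanach \<Rightarrow>\<^sub>L 'f).
            complex_operator_semigroup T \<longrightarrow>
            continuous_map euclidean complex_weak_operator_topology T \<longrightarrow>
            continuous_map euclidean strong_operator_topology T) \<and>
         (separable_space (euclidean :: 'h::chilbert_space topology) \<longrightarrow>
            infinite_cdim TYPE('h) \<longrightarrow>
            good TYPE('m) TYPE('h))"
proof (intro conjI allI impI)
  note main = weakly_continuous_semigroup_strongly_continuous[OF assms]
  show "continuous_map euclidean strong_operator_topology T"
    if "operator_semigroup T" "continuous_map euclidean real_weak_operator_topology T"
    for T :: "'m \<Rightarrow> ('e \<Rightarrow>\<^sub>L 'e)"
    using that by (intro main weakly_continuous_map_real_weak_operator)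
  show "continuous_map euclidean strong_operator_topology T"
    if "complex_operator_semigroup T" "continuous_map euclidean complex_weak_operator_topology T"
    for T :: "'m \<Rightarrow> ('f \<Rightarrow>\<^sub>L 'f)"
    using that unfolding complex_operator_semigroup_def
    by (intro main weakly_continuous_map_complex_weak_operator) simp_all
  show "good TYPE('m) TYPE('h)"
    unfolding good_def complex_operator_semigroup_def
    by (intro allI impI main weakly_continuous_map_complex_weak_operator) simp_all
qed

end
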